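(* For $d\in\mathbb{N}$ (including $d=0$) let $k_{\mathrm{comp}}(d) := 2^{d+1}(d-2)+d+4$. Let $A$ be any (possibly infinite) set, let $d\in\mathbb N$, and let $\mathcal{C}\subseteq 2^A$ be closed, non-empty, and of VC-dimension $\leq d$. Then there exists $c\in\mathcal{C}$ which is $k_{\mathrm{comp}}(d)$-compressible in $\mathcal{C}$.
   Context: $2^A$ is the space of functions $A\to\{0,1\}$ with the product topology ($\{0,1\}$ discrete). A set $\mathcal C\subseteq 2^A$ is identified with the family of subsets of $A$ whose characteristic functions lie in $\mathcal C$, and its VC-dimension is the VC-dimension of this family: the largest $n$ such that some $n$-element subset $S\subseteq A$ is shattered (every subset of $S$ is of the form $F\cap S$ with $F$ in the family). For $c\in\mathcal C$ and $B,C\subseteq A$, write $c|_B\vdash_{\mathcal C}c|_C$ if $c'|_C=c|_C$ for every $c'\in\mathcal C$ with $c'|_B=c|_B$. For $k<\omega$, $c\in\mathcal C$ is $k$-compressible in $\mathcal C$ if for every finite $A_0\subseteq A$ there is $A_1\subseteq A$ with $|A_1|\leq k$ such that $c|_{A_1}\vdash_{\mathcal C}c|_{A_0}$. *)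

theory Defs
  imports "HOL-Analysis.Function_Topology" "HOL-Library.Extended_Nat"
begin

text \<open>
  The space of functions from \<open>A\<close> to \<open>{0,1}\<close> is rendered with \<^typ>\<open>bool\<close> as the two-element set;
  its points are the functions in \<open>A \<rightarrow>\<^sub>E UNIV\<close>, that is, those with the value
  \<^term>\<open>undefined\<close> outside \<open>A\<close>.
\<close>

definition two_power :: "'a set \<Rightarrow> ('a \<Rightarrow> bool) topology" where
  "two_power A = product_topology (\<lambda>_. discrete_topology UNIV) A"

definition set_family :: "'a set \<Rightarrow> ('a \<Rightarrow> bool) set \<Rightarrow> 'a set set" where
  "set_family A \<C> = {{a \<in> A. c a} | c. c \<in> \<C>}"

definition shattered :: "'a set set \<Rightarrow> 'a set \<Rightarrow> bool" where
  "shattered \<F> S \<longleftrightarrow> (\<forall>T. T \<subseteq> S \<longrightarrow> (\<exists>F\<in>\<F>. T = F \<inter> S))"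

text \<open>
  The value is \<open>\<infinity>\<close> if there are shattered sets of unbounded finite size. The empty family, which
  shatters no set, gets the value 0.
\<close>

definition vc_dim :: "'a set \<Rightarrow> 'a set set \<Rightarrow> enat" where
  "vc_dim A \<F> = Sup {enat (card S) | S. S \<subseteq> A \<and> finite S \<and> shattered \<F> S}"

text \<open>
  \<open>entails \<C> c B D\<close> is \<open>c|\<^sub>B \<turnstile> c|\<^sub>D\<close> relative to the class \<open>\<C>\<close>.
\<close>

definition entails :: "('a \<Rightarrow> bool) set \<Rightarrow> ('a \<Rightarrow> bool) \<Rightarrow> 'a set \<Rightarrow> 'a set \<Rightarrow> bool" where
  "entails \<C> c B D \<longleftrightarrow>
     (\<forall>c'\<in>\<C>. restrict c' B = restrict c B \<longrightarrow> restrict c' D = restrict c D)"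

definition compressible :: "'a set \<Rightarrow> ('a \<Rightarrow> bool) set \<Rightarrow> nat \<Rightarrow> ('a \<Rightarrow> bool) \<Rightarrow> bool" where
  "compressible A \<C> k c \<longleftrightarrow>
     (\<forall>A0. A0 \<subseteq> A \<and> finite A0 \<longrightarrow>
       (\<exists>A1. A1 \<subseteq> A \<and> finite A1 \<and> card A1 \<le> k \<and> entails \<C> c A1 A0))"

text \<open>
  The factor \<open>d - 2\<close> is negative for \<open>d < 2\<close>, so the formula is evaluated in the integers; its
  value is never negative (it is 0, 1, 6 for \<open>d = 0, 1, 2\<close>).
\<close>

definition k_comp :: "nat \<Rightarrow> nat" where
  "k_comp d = nat (2 ^ (d + 1) * (int d - 2) + int d + 4)"

lemma int_k_comp: "int (k_comp d) = 2 ^ (d + 1) * (int d - 2) + int d + 4"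
proof -
  consider "d = 0" | "d = 1" | "d \<ge> 2" by linarith
  then have "0 \<le> 2 ^ (d + 1) * (int d - 2) + int d + 4"
  proof cases
    case 3
    then have "0 \<le> 2 ^ (d + 1) * (int d - 2)" by simp
    then show ?thesis by linarith
  qed simp_all
  then show ?thesis by (simp add: k_comp_def)
qed

end

theory Submission imports Defs begin

text \<open>
  Call a closed \<open>D \<subseteq> \<C>\<close> \<open>k\<close>-approximable if every open neighbourhood of \<open>D\<close> contains a cylinder of
  \<open>\<C>\<close>, given by at most \<open>k\<close> coordinates, which contains \<open>D\<close>. By compactness this property passes to
  intersections of chains, so there are minimal nonempty \<open>k\<close>-approximable sets. If \<open>\<C>\<close> has
  VC-dimension at most \<open>n + 1\<close> and \<open>k = 2 ^ (n + 1) * n + 1\<close>, a minimal \<open>D\<close> has VC-dimension at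
  most \<open>n\<close>: if it shattered a set \<open>Z\<close> of size \<open>n + 1\<close>, then each coordinate \<open>y\<close> of a cylinder
  around \<open>D\<close> would be determined in \<open>\<C>\<close> by some pattern on \<open>Z\<close> (as \<open>\<C>\<close> does not shatter
  \<open>insert y Z\<close>), by pigeonhole \<open>n + 1\<close> coordinates would be determined by one pattern, and
  exchanging these coordinates for \<open>Z\<close> would show that the set of members of \<open>D\<close> with that pattern
  is approximable too. Minimality replaces the choice of a smallest cylinder made by Chen, Cheng and
  Tang for finite classes. A concept of \<open>D\<close> that is compressible in \<open>D\<close> is compressible in \<open>\<C>\<close>, at
  the cost of \<open>k\<close> more coordinates, and one concludes by induction on the VC-dimension.
\<close>

section \<open>Topology of \<open>two_power A\<close>: compactness and clopen patterns\<close>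

lemma compact_two_power: "compact_space (two_power A)"
  by (simp add: two_power_def compact_space_product_topology compact_space_discrete_topology)

lemma openin_two_power_coordinate:
  assumes "a \<in> A"
  shows "openin (two_power A) {c \<in> topspace (two_power A). c a = v}"
proof -
  have "continuous_map (two_power A) (discrete_topology UNIV) (\<lambda>c. c a)"
    unfolding two_power_def using assms by (rule continuous_map_product_projection)
  from openin_continuous_map_preimage[OF this, of "{v}"] show ?thesis
    by simp
qed

text \<open>Only finitely many coordinates matter. Keeping \<open>P\<close> arbitrary carries the
  induction and makes the lemma applicable to the negated condition as well, so these sets are
  clopen.\<close>

lemma openin_two_power_pattern:
  assumes "finite Z" "Z \<subseteq> A"
  shows "openin (two_power A) {c \<in> topspace (two_power A). P {z \<in> Z. c z}}"
  using assms
proof (induction Z arbitrary: P)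
  case empty
  show ?case by (cases "P {}") auto
next
  case (insert y Z)
  let ?X = "two_power A"
  have *: "{z \<in> insert y Z. c z} = (if c y then insert y {z \<in> Z. c z} else {z \<in> Z. c z})" for c
    by auto
  have "{c \<in> topspace ?X. P {z \<in> insert y Z. c z}} =
    ({c \<in> topspace ?X. c y = True} \<inter> {c \<in> topspace ?X. P (insert y {z \<in> Z. c z})}) \<union>
    ({c \<in> topspace ?X. c y = False} \<inter> {c \<in> topspace ?X. P {z \<in> Z. c z}})"
    unfolding * by auto
  also have "openin ?X \<dots>"
    using insert by (intro openin_Un openin_Int openin_two_power_coordinate) auto
  finally show ?case .
qed

lemma closedin_two_power_pattern:
  assumes "finite Z" "Z \<subseteq> A"
  shows "closedin (two_power A) {c \<in> topspace (two_power A). P {z \<in> Z. c z}}"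
proof -
  let ?X = "two_power A"
  have "topspace ?X - {c \<in> topspace ?X. P {z \<in> Z. c z}} = {c \<in> topspace ?X. \<not> P {z \<in> Z. c z}}"
    by auto
  then show ?thesis
    using openin_two_power_pattern[OF assms, of "\<lambda>S. \<not> P S"] by (auto simp: closedin_def)
qed

text \<open>Otherwise the sets \<open>D - U\<close> are closed with nonempty finite intersections,
  because a finite nonempty subfamily of a chain contains its own intersection. Compactness then
  gives a point of \<open>\<Inter>\<D>\<close> outside \<open>U\<close>.\<close>

lemma compact_space_chain_subset:
  assumes X: "compact_space X" and chain: "subset.chain {D. closedin X D} \<D>" and ne: "\<D> \<noteq> {}"
    and U: "openin X U" "\<Inter>\<D> \<subseteq> U"
  shows "\<exists>D\<in>\<D>. D \<subseteq> U"
proof (rule ccontr)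
  assume none: "\<not> ?thesis"
  have clo: "closedin X D" if "D \<in> \<D>" for D
    using chain that by (auto simp: subset.chain_def)
  have "\<Inter>((\<lambda>D. D - U) ` \<D>) \<noteq> {}"
  proof (rule X[unfolded compact_space_fip, rule_format, OF conjI])
    show "\<forall>C\<in>(\<lambda>D. D - U) ` \<D>. closedin X C"
      using clo U(1) by auto
    show "\<forall>\<F>. finite \<F> \<and> \<F> \<subseteq> (\<lambda>D. D - U) ` \<D> \<longrightarrow> \<Inter>\<F> \<noteq> {}"
    proof (intro allI impI)
      fix \<F> assume "finite \<F> \<and> \<F> \<subseteq> (\<lambda>D. D - U) ` \<D>"
      then obtain \<E> where \<E>: "\<E> \<subseteq> \<D>" "finite \<E>" "\<F> = (\<lambda>D. D - U) ` \<E>"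
        by (metis finite_subset_image)
      show "\<Inter>\<F> \<noteq> {}"
      proof (cases "\<E> = {}")
        case False
        have "subset.chain {D. closedin X D} \<E>"
          using chain \<E>(1) unfolding subset.chain_def by blast
        then have "\<Inter>\<E> \<in> \<D>"
          using Inter_in_chain[OF \<E>(2) False] \<E>(1) by blast
        with none have "\<not> \<Inter>\<E> \<subseteq> U"
          by blast
        then show ?thesis
          using \<E>(3) by auto
      qed (simp add: \<E>(3))
    qed
  qed
  with U(2) ne show False
    by auto
qed

section \<open>Cylinders and minimal approximable sets\<close>

definition cylinder :: "('a \<Rightarrow> bool) set \<Rightarrow> 'a set \<Rightarrow> ('a \<Rightarrow> bool) \<Rightarrow> ('a \<Rightarrow> bool) set" where
  "cylinder \<C> Y b = {c \<in> \<C>. \<forall>y\<in>Y. c y = b y}"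

text \<open>Cylinders on at most \<open>k\<close> coordinates of \<open>A\<close> are the basic
  examples. Letting \<open>Y\<close> vary with \<open>U\<close> is what makes the notion survive
  limits along chains.\<close>

definition approximable :: "'a set \<Rightarrow> ('a \<Rightarrow> bool) set \<Rightarrow> nat \<Rightarrow> ('a \<Rightarrow> bool) set \<Rightarrow> bool" where
  "approximable A \<C> k D \<longleftrightarrow>
     (\<forall>U. openin (two_power A) U \<and> D \<subseteq> U \<longrightarrow>
       (\<exists>Y b. Y \<subseteq> A \<and> finite Y \<and> card Y \<le> k \<and> D \<subseteq> cylinder \<C> Y b \<and> cylinder \<C> Y b \<subseteq> U))"

lemma approximableE:
  assumes "approximable A \<C> k D" "openin (two_power A) U" "D \<subseteq> U"
  obtains Y b where "Y \<subseteq> A" "finite Y" "card Y \<le> k" "D \<subseteq> cylinder \<C> Y b" "cylinder \<C> Y b \<subseteq> U"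
  using assms unfolding approximable_def by metis

lemma approximable_self: "approximable A \<C> k \<C>"
  unfolding approximable_def
  by (intro allI impI exI[of _ "{}"]) (auto simp: cylinder_def)

lemma approximable_subset: "approximable A \<C> k D \<Longrightarrow> closedin (two_power A) D \<Longrightarrow> D \<subseteq> \<C>"
  by (erule approximableE[where U = "topspace (two_power A)"])
    (auto simp: cylinder_def dest: closedin_subset)

lemma approximable_minimal:
  assumes "closedin (two_power A) \<C>" "\<C> \<noteq> {}"
  obtains D where "closedin (two_power A) D" "D \<noteq> {}" "approximable A \<C> k D"
    "\<forall>E\<subseteq>D. closedin (two_power A) E \<longrightarrow> E \<noteq> {} \<longrightarrow> approximable A \<C> k E \<longrightarrow> E = D"
proof -
  let ?X = "two_power A"
  let ?F = "{D. closedin ?X D \<and> D \<noteq> {} \<and> approximable A \<C> k D}"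
  have "\<exists>D\<in>?F. \<forall>E\<in>?F. E \<subseteq> D \<longrightarrow> E = D"
  proof (rule predicate_Zorn)
    show "partial_order_on ?F (relation_of (\<lambda>D E. E \<subseteq> D) ?F)"
      by (rule partial_order_on_relation_ofI) auto
    fix \<D> assume "\<D> \<in> Chains (relation_of (\<lambda>D E. E \<subseteq> D) ?F)"
    then have sub: "\<D> \<subseteq> ?F" and tot: "\<And>D E. D \<in> \<D> \<Longrightarrow> E \<in> \<D> \<Longrightarrow> D \<subseteq> E \<or> E \<subseteq> D"
      by (auto simp: Chains_def relation_of_def)
    show "\<exists>E\<in>?F. \<forall>D\<in>\<D>. E \<subseteq> D"
    proof (cases "\<D> = {}")
      case True
      then show ?thesis
        using assms approximable_self by auto
    next
      case False
      have "subset.chain {D. closedin ?X D} \<D>"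
        unfolding subset.chain_def using sub tot by blast
      note nbhd = compact_space_chain_subset[OF compact_two_power this False]
      have "closedin ?X (\<Inter>\<D>)"
        using sub False by (intro closedin_Inter) auto
      moreover have "\<Inter>\<D> \<noteq> {}"
        \<comment> \<open>An empty intersection would put a member of the chain inside the open set
          \<open>{}\<close>.\<close>
        using nbhd[of "{}"] sub by auto
      moreover have "approximable A \<C> k (\<Inter>\<D>)"
        unfolding approximable_def
      proof (intro allI impI)
        fix U assume U: "openin ?X U \<and> \<Inter>\<D> \<subseteq> U"
        with nbhd obtain D where "D \<in> \<D>" "D \<subseteq> U"
          by blast
        moreover from this have "approximable A \<C> k D"
          using sub by auto
        ultimately obtain Y b where "Y \<subseteq> A" "finite Y" "card Y \<le> k"
            "D \<subseteq> cylinder \<C> Y b" "cylinder \<C> Y b \<subseteq> U"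
          using U by (elim approximableE) auto
        with \<open>D \<in> \<D>\<close>
        show "\<exists>Y b. Y \<subseteq> A \<and> finite Y \<and> card Y \<le> k \<and> \<Inter>\<D> \<subseteq> cylinder \<C> Y b \<and> cylinder \<C> Y b \<subseteq> U"
          by blast
      qed
      ultimately show ?thesis
        by blast
    qed
  qed
  then show ?thesis
    using that by blast
qed

section \<open>Shattering and the exchange of coordinates\<close>

lemma shattered_set_family_iff:
  assumes "Z \<subseteq> A"
  shows "shattered (set_family A \<C>) Z \<longleftrightarrow> (\<forall>T\<subseteq>Z. \<exists>c\<in>\<C>. {z \<in> Z. c z} = T)"
proof -
  have "{a \<in> A. c a} \<inter> Z = {z \<in> Z. c z}" for c
    using assms by auto
  moreover have "set_family A \<C> = (\<lambda>c. {a \<in> A. c a}) ` \<C>"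
    by (auto simp: set_family_def)
  ultimately show ?thesis
    by (simp add: shattered_def) metis
qed

lemma shattered_set_family_mono:
  assumes "shattered (set_family A D) Z" "D \<subseteq> \<C>"
  shows "shattered (set_family A \<C>) Z"
proof -
  have "set_family A D \<subseteq> set_family A \<C>"
    using assms(2) by (auto simp: set_family_def)
  with assms(1) show ?thesis
    unfolding shattered_def by (meson subsetD)
qed

lemma vc_dim_le_iff:
  "vc_dim A \<F> \<le> enat n \<longleftrightarrow> (\<forall>Z\<subseteq>A. finite Z \<longrightarrow> shattered \<F> Z \<longrightarrow> card Z \<le> n)"
  unfolding vc_dim_def Sup_le_iff by (auto simp flip: enat_ord_simps(1))

text \<open>If \<open>card Y = card R * n + 1\<close>, this is the usual pigeonhole principle; a
  smaller \<open>Y\<close> needs a correspondingly smaller fibre. The form matches the exchange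
  below, which drops one fibre and adds \<open>Suc n\<close> coordinates.\<close>

lemma pigeonhole_fibre:
  fixes g :: "'a \<Rightarrow> 'b"
  assumes fin: "finite Y" "finite R" and g: "g ` Y \<subseteq> R" and R: "R \<noteq> {}"
    and Y: "card Y \<le> card R * n + 1"
  shows "\<exists>t\<in>R. card {y \<in> Y. g y \<noteq> t} + Suc n \<le> card R * n + 1"
proof (rule ccontr)
  let ?m = "card R"
  assume "\<not> ?thesis"
  then have big: "?m * n + 1 < card {y \<in> Y. g y \<noteq> t} + Suc n" if "t \<in> R" for t
    using that by force
  have split: "card Y = card {y \<in> Y. g y = t} + card {y \<in> Y. g y \<noteq> t}" for t
    using card_Un_disjoint[of "{y \<in> Y. g y = t}" "{y \<in> Y. g y \<noteq> t}"] fin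
    by (auto simp flip: Collect_disj_eq conj_disj_distribL)
  \<comment> \<open>The right-hand side may be negative, hence the integers.\<close>
  have fib: "int (card {y \<in> Y. g y = t}) \<le> int (card Y) + int n - int (?m * n + 1)" if "t \<in> R" for t
    using big[OF that] split[of t] by linarith
  have "int (card Y) = (\<Sum>t\<in>R. int (card {y \<in> Y. g y = t}))"
    using sum_fun_comp[OF fin g, of "\<lambda>_. 1::int"] by simp
  also have "\<dots> \<le> int ?m * (int (card Y) + int n - int (?m * n + 1))"
    using sum_bounded_above[of R _ "int (card Y) + int n - int (?m * n + 1)"] fib by simp
  finally have *: "int (card Y) \<le> int ?m * (int (card Y) + int n - int (?m * n + 1))" .
  have "?m \<ge> 1"
    using fin R by (simp add: Suc_leI card_gt_0_iff)
  then have "0 \<le> (int ?m - 1) * (int ?m * int n + 1 - int (card Y))"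
    using Y by (intro mult_nonneg_nonneg) (simp_all flip: of_nat_mult)
  with * show False
    by (simp add: algebra_simps)
qed

text \<open>Coordinates forced to their value in \<open>b\<close> by the pattern \<open>T\<close>
  become redundant once \<open>Z\<close> is fixed to \<open>T\<close>. Pigeonhole over the
  \<open>2 ^ Suc n\<close> patterns finds a \<open>T\<close> for which this pays for the
  \<open>Suc n\<close> new coordinates.\<close>

lemma cylinder_exchange:
  assumes vc: "vc_dim A (set_family A \<C>) \<le> enat (Suc n)"
    and D: "D \<subseteq> cylinder \<C> Y b"
    and Z: "Z \<subseteq> A" "finite Z" "card Z = Suc n" "shattered (set_family A D) Z"
    and Y: "Y \<subseteq> A" "finite Y" "card Y \<le> 2 ^ Suc n * n + 1"
  obtains T W b' where "T \<subseteq> Z" "W \<subseteq> A" "finite W" "card W \<le> 2 ^ Suc n * n + 1"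
    "cylinder \<C> W b' = cylinder \<C> Y b \<inter> {c. {z \<in> Z. c z} = T}"
proof -
  have pat: "\<exists>c\<in>D. {z \<in> Z. c z} = T" if "T \<subseteq> Z" for T
    using Z(4) that unfolding shattered_set_family_iff[OF Z(1)] by blast
  have "\<exists>T\<subseteq>Z. \<forall>c\<in>\<C>. {z \<in> Z. c z} = T \<longrightarrow> c y = b y" if y: "y \<in> Y" for y
  proof -
    have cy: "c y = b y" if "c \<in> D" for c
      using D that y by (auto simp: cylinder_def)
    \<comment> \<open>Members of \<open>D\<close> all take the value \<open>b y\<close> at
      \<open>y\<close>, but both values at each point of \<open>Z\<close>.\<close>
    have "y \<notin> Z"
    proof
      assume "y \<in> Z"
      obtain c where "c \<in> D" "{z \<in> Z. c z} = (if b y then {} else {y})"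
        using pat[of "if b y then {} else {y}"] \<open>y \<in> Z\<close> by (cases "b y") auto
      then show False
        using cy[of c] \<open>y \<in> Z\<close> by (auto split: if_splits)
    qed
    then have "card (insert y Z) = Suc (Suc n)"
      using Z by simp
    then have "\<not> shattered (set_family A \<C>) (insert y Z)"
      using vc Z y Y unfolding vc_dim_le_iff by (metis Suc_n_not_le_n finite_insert insert_subset subsetD)
    moreover have "insert y Z \<subseteq> A"
      using y Y Z by auto
    ultimately obtain T where T: "T \<subseteq> insert y Z" "\<And>c. c \<in> \<C> \<Longrightarrow> {z \<in> insert y Z. c z} \<noteq> T"
      by (auto simp: shattered_set_family_iff)
    have *: "(y \<in> T) \<noteq> c y" if "c \<in> \<C>" "{z \<in> Z. c z} = T \<inter> Z" for c
      using T(2)[OF that(1)] that(2) T(1) by blast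
    \<comment> \<open>In \<open>\<C>\<close> the missing pattern forces one value at
      \<open>y\<close>; a member of \<open>D\<close> with the same trace on \<open>Z\<close> shows
      that this value is \<open>b y\<close>.\<close>
    obtain c0 where "c0 \<in> D" "{z \<in> Z. c0 z} = T \<inter> Z"
      using pat[of "T \<inter> Z"] by auto
    moreover from this have "c0 \<in> \<C>"
      using D by (auto simp: cylinder_def)
    ultimately have "(y \<in> T) \<noteq> b y"
      using *[of c0] cy by blast
    with * show ?thesis
      by (intro exI[of _ "T \<inter> Z"]) auto
  qed
  then have "\<forall>y\<in>Y. \<exists>T. T \<subseteq> Z \<and> (\<forall>c\<in>\<C>. {z \<in> Z. c z} = T \<longrightarrow> c y = b y)"
    by blast
  from bchoice[OF this] obtain g where
    "\<forall>y\<in>Y. g y \<subseteq> Z \<and> (\<forall>c\<in>\<C>. {z \<in> Z. c z} = g y \<longrightarrow> c y = b y)" ..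
  then have g: "\<And>y. y \<in> Y \<Longrightarrow> g y \<subseteq> Z"
      "\<And>y c. y \<in> Y \<Longrightarrow> c \<in> \<C> \<Longrightarrow> {z \<in> Z. c z} = g y \<Longrightarrow> c y = b y"
    by simp_all
  have card: "card (Pow Z) = 2 ^ Suc n"
    using Z by (simp add: card_Pow)
  obtain T where T: "T \<in> Pow Z" "card {y \<in> Y. g y \<noteq> T} + Suc n \<le> card (Pow Z) * n + 1"
    using pigeonhole_fibre[of Y "Pow Z" g n] Y Z g(1) card by (auto simp: image_subset_iff)
  define W where "W = {y \<in> Y. g y \<noteq> T} \<union> Z"
  define b' where "b' y = (if y \<in> Z then y \<in> T else b y)" for y
  have "card W \<le> 2 ^ Suc n * n + 1"
    using T(2) card Z card_Un_le[of "{y \<in> Y. g y \<noteq> T}" Z] by (simp add: W_def)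
  moreover have "cylinder \<C> W b' = cylinder \<C> Y b \<inter> {c. {z \<in> Z. c z} = T}"
  proof -
    have 3: "c \<in> cylinder \<C> W b' \<longleftrightarrow> c \<in> cylinder \<C> Y b" if "{z \<in> Z. c z} = T" for c
    proof -
      have 1: "c z = b' z" if "z \<in> Z" for z
        using \<open>{z \<in> Z. c z} = T\<close> that by (auto simp: b'_def)
      have 2: "c y = b y" if "c \<in> cylinder \<C> W b'" "y \<in> Y" for y
      proof (cases "g y = T")
        case True
        then show ?thesis
          using g(2) that \<open>{z \<in> Z. c z} = T\<close> by (auto simp: cylinder_def)
      next
        case False
        \<comment> \<open>The prescriptions \<open>T\<close> on \<open>Z\<close> and
          \<open>b\<close> on \<open>Y\<close> cannot conflict, since some member of
          \<open>D\<close> satisfies both.\<close>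
        have "y \<notin> Z \<or> b' y = b y"
        proof (rule ccontr)
          assume *: "\<not> ?thesis"
          obtain c' where "c' \<in> D" "{z \<in> Z. c' z} = T"
            using pat T(1) by auto
          with * that(2) D show False
            by (auto simp: b'_def cylinder_def)
        qed
        with False that show ?thesis
          by (auto simp: cylinder_def W_def b'_def)
      qed
      have "\<forall>y\<in>W. c y = b' y" if "c \<in> cylinder \<C> Y b"
      proof
        fix y assume "y \<in> W"
        then show "c y = b' y"
          using 1[of y] that by (cases "y \<in> Z") (simp_all add: cylinder_def W_def b'_def)
      qed
      moreover have "c \<in> \<C>" if "c \<in> cylinder \<C> Y b \<or> c \<in> cylinder \<C> W b'"
        using that by (auto simp: cylinder_def)
      ultimately show ?thesis
        using 2 unfolding cylinder_def by blast
    qed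
    have 4: "{z \<in> Z. c z} = T" if "c \<in> cylinder \<C> W b'" for c
      using that T(1) by (auto simp: cylinder_def W_def b'_def)
    show ?thesis
    proof (rule set_eqI)
      fix c
      show "c \<in> cylinder \<C> W b' \<longleftrightarrow> c \<in> cylinder \<C> Y b \<inter> {c. {z \<in> Z. c z} = T}"
        using 3[of c] 4[of c] by auto
    qed
  qed
  moreover have "W \<subseteq> A" "finite W"
    using Z Y by (auto simp: W_def)
  ultimately show ?thesis
    using T(1) by (intro that[of T W b']) simp_all
qed

text \<open>If \<open>D\<close> shattered \<open>Z\<close> of size \<open>Suc n\<close>, its slices
  \<open>E T\<close> would be nonempty proper closed subsets, so by minimality none is approximable.
  Neighbourhoods witnessing this, glued to one neighbourhood of \<open>D\<close>, contradict the
  exchange lemma.\<close>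

lemma minimal_approximable_vc_dim:
  assumes vc: "vc_dim A (set_family A \<C>) \<le> enat (Suc n)"
    and D: "closedin (two_power A) D" "approximable A \<C> (2 ^ Suc n * n + 1) D"
    and min: "\<forall>E\<subseteq>D. closedin (two_power A) E \<longrightarrow> E \<noteq> {} \<longrightarrow>
      approximable A \<C> (2 ^ Suc n * n + 1) E \<longrightarrow> E = D"
  shows "vc_dim A (set_family A D) \<le> enat n"
proof (rule ccontr)
  let ?X = "two_power A" and ?k = "2 ^ Suc n * n + 1"
  assume "\<not> ?thesis"
  then obtain Z where Z: "Z \<subseteq> A" "finite Z" "shattered (set_family A D) Z" "\<not> card Z \<le> n"
    unfolding vc_dim_le_iff by blast
  have "D \<subseteq> \<C>"
    using approximable_subset D by blast
  then have "card Z = Suc n"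
    using vc Z shattered_set_family_mono[OF Z(3)] unfolding vc_dim_le_iff
    by (metis le_SucE)
  have pat: "\<exists>c\<in>D. {z \<in> Z. c z} = T" if "T \<subseteq> Z" for T
    using Z(3) that unfolding shattered_set_family_iff[OF Z(1)] by blast
  define E where "E T = {c \<in> D. {z \<in> Z. c z} = T}" for T
  have not_approx: "\<not> approximable A \<C> ?k (E T)" if "T \<subseteq> Z" for T
  proof
    assume *: "approximable A \<C> ?k (E T)"
    have "E T = D \<inter> {c \<in> topspace ?X. {z \<in> Z. c z} = T}"
      using closedin_subset[OF D(1)] by (auto simp: E_def)
    then have "closedin ?X (E T)"
      using closedin_Int[OF D(1) closedin_two_power_pattern[OF Z(2,1), of "\<lambda>S. S = T"]] by simp
    moreover have "E T \<noteq> {}"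
      using pat[OF that] by (auto simp: E_def)
    ultimately have "E T = D"
      using min * by (auto simp: E_def)
    \<comment> \<open>\<open>Z\<close> is nonempty, so it has a second pattern, which
      \<open>D\<close> realises outside \<open>E T\<close>.\<close>
    obtain T' where "T' \<subseteq> Z" "T' \<noteq> T"
      using \<open>card Z = Suc n\<close> by (metis card.empty empty_subsetI nat.distinct(1) order_refl)
    obtain c where "c \<in> D" "{z \<in> Z. c z} = T'"
      using pat[OF \<open>T' \<subseteq> Z\<close>] by auto
    moreover from this have "c \<in> E T"
      using \<open>E T = D\<close> by simp
    ultimately show False
      using \<open>T' \<noteq> T\<close> by (simp add: E_def)
  qed
  have "\<forall>T\<in>Pow Z. \<exists>U. openin ?X U \<and> E T \<subseteq> U \<and> \<not> (\<exists>Y b. Y \<subseteq> A \<and> finite Y \<and> card Y \<le> ?k \<and>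
      E T \<subseteq> cylinder \<C> Y b \<and> cylinder \<C> Y b \<subseteq> U)"
    using not_approx by (simp only: approximable_def not_all not_imp conj_assoc Pow_iff) blast
  from bchoice[OF this] obtain U where
    "\<forall>T\<in>Pow Z. openin ?X (U T) \<and> E T \<subseteq> U T \<and> \<not> (\<exists>Y b. Y \<subseteq> A \<and> finite Y \<and> card Y \<le> ?k \<and>
      E T \<subseteq> cylinder \<C> Y b \<and> cylinder \<C> Y b \<subseteq> U T)" ..
  then have U: "\<And>T. T \<subseteq> Z \<Longrightarrow> openin ?X (U T)" "\<And>T. T \<subseteq> Z \<Longrightarrow> E T \<subseteq> U T"
      "\<And>T Y b. T \<subseteq> Z \<Longrightarrow> Y \<subseteq> A \<Longrightarrow> finite Y \<Longrightarrow> card Y \<le> ?k \<Longrightarrow>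
        E T \<subseteq> cylinder \<C> Y b \<Longrightarrow> \<not> cylinder \<C> Y b \<subseteq> U T"
    by (simp, simp, blast)
  \<comment> \<open>The exchange lemma does not control which pattern it returns, so all are treated at once.\<close>
  define V where "V = (\<Union>T\<in>Pow Z. U T \<inter> {c \<in> topspace ?X. {z \<in> Z. c z} = T})"
  have "openin ?X V"
    unfolding V_def using U(1) openin_two_power_pattern[OF Z(2,1), of "\<lambda>S. S = T" for T]
    by (intro openin_Union) auto
  moreover have "D \<subseteq> V"
  proof
    fix c assume "c \<in> D"
    moreover from this have "c \<in> E {z \<in> Z. c z}"
      by (auto simp: E_def)
    then have "c \<in> U {z \<in> Z. c z}"
      using U(2)[of "{z \<in> Z. c z}"] by blast
    ultimately show "c \<in> V"
      using closedin_subset[OF D(1)] by (auto simp: V_def)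
  qed
  ultimately obtain Y b where Y: "Y \<subseteq> A" "finite Y" "card Y \<le> ?k"
      "D \<subseteq> cylinder \<C> Y b" "cylinder \<C> Y b \<subseteq> V"
    using D(2) by (elim approximableE)
  obtain T W b' where T: "T \<subseteq> Z" and W: "W \<subseteq> A" "finite W" "card W \<le> ?k"
      "cylinder \<C> W b' = cylinder \<C> Y b \<inter> {c. {z \<in> Z. c z} = T}"
    by (rule cylinder_exchange[OF vc Y(4) Z(1,2) \<open>card Z = Suc n\<close> Z(3) Y(1-3)])
  have "E T \<subseteq> cylinder \<C> W b'"
    using W(4) Y(4) by (auto simp: E_def)
  \<comment> \<open>On concepts with pattern \<open>T\<close>, membership in \<open>V\<close>
    reduces to membership in \<open>U T\<close>.\<close>
  moreover have "cylinder \<C> W b' \<subseteq> U T"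
    using W(4) Y(5) by (auto simp: V_def)
  ultimately show False
    using U(3)[OF T W(1-3)] by blast
qed

section \<open>Compressibility and the induction on the VC-dimension\<close>

lemma entails_iff:
  "entails \<C> c B D \<longleftrightarrow> (\<forall>c'\<in>\<C>. (\<forall>x\<in>B. c' x = c x) \<longrightarrow> (\<forall>x\<in>D. c' x = c x))"
  unfolding entails_def by (auto simp: restrict_def fun_eq_iff)

text \<open>Entailment between finite sets of coordinates is an open condition, so what holds on
  \<open>D\<close> holds on a cylinder around \<open>D\<close>. Adding the coordinates of that
  cylinder confines the competing concepts to it.\<close>

lemma compressible_approximable:
  assumes D: "closedin (two_power A) D" "approximable A \<C> k D"
    and c: "c \<in> D" "compressible A D l c"
  shows "compressible A \<C> (l + k) c"
  unfolding compressible_def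
proof (intro allI impI)
  let ?X = "two_power A"
  fix A0 assume A0: "A0 \<subseteq> A \<and> finite A0"
  then obtain A1 where A1: "A1 \<subseteq> A" "finite A1" "card A1 \<le> l" "entails D c A1 A0"
    using c(2) unfolding compressible_def by blast
  \<comment> \<open>The concepts satisfying the implication from agreement with \<open>c\<close> on
    \<open>A1\<close> to agreement on \<open>A0\<close>.\<close>
  define U where "U = {c' \<in> topspace ?X. {x \<in> A1. c' x} \<noteq> {x \<in> A1. c x}} \<union>
    {c' \<in> topspace ?X. {x \<in> A0. c' x} = {x \<in> A0. c x}}"
  have "openin ?X U"
    unfolding U_def using A0 A1 openin_two_power_pattern[of A1 A "\<lambda>S. S \<noteq> {x \<in> A1. c x}"]
      openin_two_power_pattern[of A0 A "\<lambda>S. S = {x \<in> A0. c x}"]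
    by (intro openin_Un) auto
  moreover have "D \<subseteq> U"
    using A1(4) closedin_subset[OF D(1)] unfolding entails_iff U_def by blast
  ultimately obtain Y b where Y: "Y \<subseteq> A" "finite Y" "card Y \<le> k"
      "D \<subseteq> cylinder \<C> Y b" "cylinder \<C> Y b \<subseteq> U"
    using D(2) by (elim approximableE)
  have "entails \<C> c (A1 \<union> Y) A0"
    unfolding entails_iff
  proof (intro ballI impI)
    fix c' x assume c': "c' \<in> \<C>" "\<forall>x\<in>A1 \<union> Y. c' x = c x" and x: "x \<in> A0"
    \<comment> \<open>As \<open>c\<close> lies in \<open>D\<close>, it agrees with \<open>b\<close>
      on \<open>Y\<close>, and so does \<open>c'\<close>.\<close>
    have "c' \<in> cylinder \<C> Y b"
      using c' c(1) Y(4) by (auto simp: cylinder_def)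
    then have "c' \<in> U"
      using Y(5) by blast
    with c'(2) have "{x \<in> A0. c' x} = {x \<in> A0. c x}"
      unfolding U_def by blast
    with x show "c' x = c x"
      by blast
  qed
  moreover have "card (A1 \<union> Y) \<le> l + k"
    using card_Un_le[of A1 Y] A1(3) Y(3) by linarith
  ultimately show "\<exists>A1. A1 \<subseteq> A \<and> finite A1 \<and> card A1 \<le> l + k \<and> entails \<C> c A1 A0"
    using A1 Y by (intro exI[of _ "A1 \<union> Y"]) auto
qed

text \<open>The increment is the number of coordinates paid for one drop in dimension; with
  \<open>k_comp 0 = 0\<close> this recurrence gives the closed formula.\<close>

lemma k_comp_Suc: "k_comp (Suc n) = k_comp n + (2 ^ Suc n * n + 1)"
proof -
  have "int (k_comp (Suc n)) = int (k_comp n + (2 ^ Suc n * n + 1))"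
    by (simp add: int_k_comp algebra_simps)
  then show ?thesis
    by linarith
qed

theorem theorem3p4:
  fixes A :: "'a set" and \<C> :: "('a \<Rightarrow> bool) set" and d :: nat
  assumes "closedin (two_power A) \<C>"
    and "\<C> \<noteq> {}"
    and "vc_dim A (set_family A \<C>) \<le> enat d"
  shows "\<exists>c\<in>\<C>. compressible A \<C> (k_comp d) c"
  using assms
proof (induction d arbitrary: \<C>)
  case 0
  obtain c where c: "c \<in> \<C>"
    using 0 by blast
  \<comment> \<open>Two concepts differing at \<open>x\<close> would shatter \<open>{x}\<close>.
    Hence all members agree on \<open>A\<close>, and the empty set of coordinates suffices.\<close>
  have "c' x = c x" if "c' \<in> \<C>" "x \<in> A" for c' x
  proof (rule ccontr)
    assume ne: "c' x \<noteq> c x"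
    have "\<exists>c\<in>\<C>. {z \<in> {x}. c z} = T" if "T \<subseteq> {x}" for T
    proof (cases "c x \<longleftrightarrow> x \<in> T")
      case True
      then have "{z \<in> {x}. c z} = T"
        using that by auto
      with c show ?thesis by blast
    next
      case False
      then have "{z \<in> {x}. c' z} = T"
        using that ne by auto
      with \<open>c' \<in> \<C>\<close> show ?thesis by blast
    qed
    then have "shattered (set_family A \<C>) {x}"
      using that(2) by (subst shattered_set_family_iff) auto
    then have "card {x} \<le> 0"
      using 0(3)[unfolded vc_dim_le_iff, rule_format, of "{x}"] that(2) by blast
    then show False
      by simp
  qed
  then have "compressible A \<C> (k_comp 0) c"
    unfolding compressible_def entails_iff by (metis card.empty empty_subsetI finite.emptyI subsetD zero_le)
  with c show ?case by blast
next
  case (Suc n)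
  obtain D where D: "closedin (two_power A) D" "D \<noteq> {}" "approximable A \<C> (2 ^ Suc n * n + 1) D"
    and min: "\<forall>E\<subseteq>D. closedin (two_power A) E \<longrightarrow> E \<noteq> {} \<longrightarrow>
      approximable A \<C> (2 ^ Suc n * n + 1) E \<longrightarrow> E = D"
    by (rule approximable_minimal[OF Suc.prems(1,2), of "2 ^ Suc n * n + 1"])
  have "vc_dim A (set_family A D) \<le> enat n"
    using minimal_approximable_vc_dim[OF Suc.prems(3) D(1,3) min] .
  then obtain c where c: "c \<in> D" "compressible A D (k_comp n) c"
    using Suc.IH[OF D(1,2)] by blast
  then have "compressible A \<C> (k_comp (Suc n)) c"
    unfolding k_comp_Suc using compressible_approximable D by blast
  moreover have "c \<in> \<C>"
    using approximable_subset D c(1) by blast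
  ultimately show ?case by blast
qed

end
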